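(* Let $\lambda_1,\lambda_2,\lambda_3\in\mathbb{R}$ and let $\mathbb{K}$ be the associated algebra of 3-parameter generalized quaternions. Let $p\in\mathbb{K}$ with $N_p=1$ have polar expression $p=\cos\theta+v\sin\theta$ with $v\in S^2_{\mathbb{K}}$, suppose $m=\frac{2\pi}{\theta}\in\mathbb{Z}^{+}\setminus\{1\}$, and let $A$ be the $4\times 4$ real matrix representation of $p$. Then for integers $n,s$: $n\equiv s\pmod m$ if and only if $A^n=A^s$.
   Context: Given $\lambda_1,\lambda_2,\lambda_3\in\mathbb{R}$, $\mathbb{K}$ is the (associative, unital) real algebra with vector-space basis $1,e_1,e_2,e_3$, unit $1$, and bilinear multiplication determined by $e_1^2=-\lambda_1\lambda_2$, $e_2^2=-\lambda_1\lambda_3$, $e_3^2=-\lambda_2\lambda_3$, $e_1e_2=\lambda_1e_3=-e_2e_1$, $e_2e_3=\lambda_3e_1=-e_3e_2$, $e_3e_1=\lambda_2e_2=-e_1e_3$. For $p=a_0+a_1e_1+a_2e_2+a_3e_3\in\mathbb{K}$ (with $a_i\in\mathbb{R}$), the norm is $N_p=a_0^2+\lambda_1\lambda_2a_1^2+\lambda_1\lambda_3a_2^2+\lambda_2\lambda_3a_3^2$. $\mathrm{Im}(\mathbb{K})=\{a_1e_1+a_2e_2+a_3e_3:a_i\in\mathbb{R}\}$ and $S^2_{\mathbb{K}}=\{h\in\mathrm{Im}(\mathbb{K}):N_h=1\}$. The matrix representation of $p$ is the matrix of left multiplication $q\mapsto pq$ in the basis $1,e_1,e_2,e_3$, namely $$\begin{bmatrix}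 a_0 & -\lambda_1\lambda_2 a_1 & -\lambda_1\lambda_3 a_2 & -\lambda_2\lambda_3 a_3 \\ a_1 & a_0 & -\lambda_3 a_3 & \lambda_3 a_2 \\ a_2 & \lambda_2 a_3 & a_0 & -\lambda_2 a_1 \\ a_3 & -\lambda_1 a_2 & \lambda_1 a_1 & a_0 \end{bmatrix}.$$ Negative powers of $A$ are powers of its inverse. *)

theory Defs
  imports "HOL-Analysis.Analysis" "HOL-Number_Theory.Cong"
begin

(* An element a0 + a1 e1 + a2 e2 + a3 e3 is the vector (a0, a1, a2, a3); the indices
   1, 2, 3, 4 of the type 4 stand for the basis vectors 1, e1, e2, e3.
   The parameters l1, l2, l3 enter only through the multiplication and the norm.
   The type-class constant 1 and the operations * and ^ are componentwise on real^4
   and on matrices, and are therefore not used here. *)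
type_synonym gquat = "real ^ 4"

definition gq :: "real \<Rightarrow> real \<Rightarrow> real \<Rightarrow> real \<Rightarrow> gquat" where
  "gq a0 a1 a2 a3 = vector [a0, a1, a2, a3]"

definition gq_one :: gquat where "gq_one = gq 1 0 0 0"
definition gq_e1 :: gquat where "gq_e1 = gq 0 1 0 0"
definition gq_e2 :: gquat where "gq_e2 = gq 0 0 1 0"
definition gq_e3 :: gquat where "gq_e3 = gq 0 0 0 1"

(* The coordinates obtained by expanding bilinearly; lemmas bilinear_gq_mult, gq_mult_one
   and gq_mult_basis below show that this is the product given by the multiplication table. *)
definition gq_mult :: "real \<Rightarrow> real \<Rightarrow> real \<Rightarrow> gquat \<Rightarrow> gquat \<Rightarrow> gquat" where
  "gq_mult l1 l2 l3 p q = gq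
     (p$1 * q$1 - l1 * l2 * (p$2 * q$2) - l1 * l3 * (p$3 * q$3) - l2 * l3 * (p$4 * q$4))
     (p$1 * q$2 + p$2 * q$1 + l3 * (p$3 * q$4 - p$4 * q$3))
     (p$1 * q$3 + p$3 * q$1 + l2 * (p$4 * q$2 - p$2 * q$4))
     (p$1 * q$4 + p$4 * q$1 + l1 * (p$2 * q$3 - p$3 * q$2))"

definition gq_norm :: "real \<Rightarrow> real \<Rightarrow> real \<Rightarrow> gquat \<Rightarrow> real" where
  "gq_norm l1 l2 l3 p =
     (p$1)\<^sup>2 + l1 * l2 * (p$2)\<^sup>2 + l1 * l3 * (p$3)\<^sup>2 + l2 * l3 * (p$4)\<^sup>2"

definition gq_Im :: "gquat set" where
  "gq_Im = {a1 *\<^sub>R gq_e1 + a2 *\<^sub>R gq_e2 + a3 *\<^sub>R gq_e3 | a1 a2 a3. True}"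

definition gq_S2 :: "real \<Rightarrow> real \<Rightarrow> real \<Rightarrow> gquat set" where
  "gq_S2 l1 l2 l3 = {h \<in> gq_Im. gq_norm l1 l2 l3 h = 1}"

definition gq_matrix :: "real \<Rightarrow> real \<Rightarrow> real \<Rightarrow> gquat \<Rightarrow> real ^ 4 ^ 4" where
  "gq_matrix l1 l2 l3 p = matrix (gq_mult l1 l2 l3 p)"

definition matrix_powi :: "'a::semiring_1 ^ 'n ^ 'n \<Rightarrow> int \<Rightarrow> 'a ^ 'n ^ 'n" where
  "matrix_powi A n =
     (if 0 \<le> n then (((**) A) ^^ nat n) (mat 1)
      else (((**) (matrix_inv A)) ^^ nat (- n)) (mat 1))"

lemma gq_nth [simp]:
  "gq a0 a1 a2 a3 $ 1 = a0" "gq a0 a1 a2 a3 $ 2 = a1"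
  "gq a0 a1 a2 a3 $ 3 = a2" "gq a0 a1 a2 a3 $ 4 = a3"
  by (simp_all add: gq_def vector_def)

lemma bilinear_gq_mult: "bilinear (gq_mult l1 l2 l3)"
  by (auto simp: bilinear_def gq_mult_def vec_eq_iff forall_4 algebra_simps intro!: linearI)

lemma gq_mult_one [simp]:
  "gq_mult l1 l2 l3 gq_one p = p" "gq_mult l1 l2 l3 p gq_one = p"
  by (simp_all add: gq_mult_def gq_one_def vec_eq_iff forall_4)

lemma gq_mult_basis:
  "gq_mult l1 l2 l3 gq_e1 gq_e1 = - (l1 * l2) *\<^sub>R gq_one"
  "gq_mult l1 l2 l3 gq_e2 gq_e2 = - (l1 * l3) *\<^sub>R gq_one"
  "gq_mult l1 l2 l3 gq_e3 gq_e3 = - (l2 * l3) *\<^sub>R gq_one"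
  "gq_mult l1 l2 l3 gq_e1 gq_e2 = l1 *\<^sub>R gq_e3"
  "gq_mult l1 l2 l3 gq_e2 gq_e1 = - l1 *\<^sub>R gq_e3"
  "gq_mult l1 l2 l3 gq_e2 gq_e3 = l3 *\<^sub>R gq_e1"
  "gq_mult l1 l2 l3 gq_e3 gq_e2 = - l3 *\<^sub>R gq_e1"
  "gq_mult l1 l2 l3 gq_e3 gq_e1 = l2 *\<^sub>R gq_e2"
  "gq_mult l1 l2 l3 gq_e1 gq_e3 = - l2 *\<^sub>R gq_e2"
  by (simp_all add: gq_mult_def gq_one_def gq_e1_def gq_e2_def gq_e3_def vec_eq_iff forall_4)

lemma gq_mult_assoc:
  "gq_mult l1 l2 l3 (gq_mult l1 l2 l3 p q) r = gq_mult l1 l2 l3 p (gq_mult l1 l2 l3 q r)"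
  by (simp add: gq_mult_def vec_eq_iff forall_4 algebra_simps)

lemma gq_matrix_gq:
  "gq_matrix l1 l2 l3 (gq a0 a1 a2 a3) = vector
     [vector [a0, - l1 * l2 * a1, - l1 * l3 * a2, - l2 * l3 * a3],
      vector [a1, a0, - l3 * a3, l3 * a2],
      vector [a2, l2 * a3, a0, - l2 * a1],
      vector [a3, - l1 * a2, l1 * a1, a0]]"
  by (simp add: gq_matrix_def matrix_def gq_mult_def vec_eq_iff forall_4 axis_def vector_def)

lemma gq_matrix_mult:
  "gq_matrix l1 l2 l3 p ** gq_matrix l1 l2 l3 q = gq_matrix l1 l2 l3 (gq_mult l1 l2 l3 p q)"
  by (simp add: gq_matrix_def matrix_def gq_mult_def vec_eq_iff forall_4 axis_def
      matrix_matrix_mult_def sum_4 algebra_simps)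

(* Hence matrix_inv, which is unspecified on singular matrices, is the actual inverse
   for p of norm 1. *)
lemma invertible_gq_matrix:
  assumes "gq_norm l1 l2 l3 p = 1"
  shows "invertible (gq_matrix l1 l2 l3 p)"
proof -
  let ?q = "gq (p$1) (- p$2) (- p$3) (- p$4)"
  have "gq_mult l1 l2 l3 p ?q = gq_one" "gq_mult l1 l2 l3 ?q p = gq_one"
    using assms
    by (simp_all add: gq_mult_def gq_norm_def gq_one_def vec_eq_iff forall_4
        power2_eq_square algebra_simps)
  moreover have "gq_matrix l1 l2 l3 gq_one = mat 1"
    by (simp add: gq_matrix_def matrix_def mat_def vec_eq_iff forall_4 axis_def)
  ultimately show ?thesis
    unfolding invertible_def by (metis gq_matrix_mult)
qed

end

theory Submission
  imports Defs
begin

text \<open>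
  A vector \<open>v\<close> in \<open>S\<^sup>2\<close> satisfies \<open>v\<^sup>2 = - 1\<close>, so \<open>1\<close> and \<open>v\<close> span a copy of the complex
  numbers, in which \<open>cos t + sin t v\<close> plays the role of \<open>exp (i t)\<close>. The angle addition formulas
  make \<open>t \<mapsto> cos t + sin t v\<close> a homomorphism from the additive reals (lemma \<open>gq_polar_add\<close>), so
  passing to left multiplication matrices gives De Moivre's formula: the \<open>n\<close>-th power of the
  matrix at angle \<open>t\<close> is the matrix at angle \<open>n t\<close>, for all integers \<open>n\<close> (lemma
  \<open>matrix_powi_polar\<close>).

  The kernel of this homomorphism is \<open>2 \<pi> \<int>\<close>, because \<open>1\<close> and \<open>v\<close> are linearly independent and
  an element can be recovered from its matrix (lemmas \<open>gq_polar_eq_iff\<close> and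
  \<open>gq_matrix_eq_iff\<close>). Hence the \<open>n\<close>-th and \<open>s\<close>-th powers agree exactly when \<open>n \<theta>\<close> and \<open>s \<theta>\<close>
  differ by a multiple of \<open>2 \<pi>\<close>, and with \<open>\<theta> = 2 \<pi> / m\<close> this says that \<open>m\<close> divides \<open>n - s\<close>.
\<close>

definition gq_polar :: "gquat \<Rightarrow> real \<Rightarrow> gquat" where
  "gq_polar v t = cos t *\<^sub>R gq_one + sin t *\<^sub>R v"

lemma gq_S2_nth_1:
  assumes "v \<in> gq_S2 l1 l2 l3"
  shows "v $ 1 = 0"
  using assms by (auto simp: gq_S2_def gq_Im_def gq_e1_def gq_e2_def gq_e3_def)

lemma gq_S2_nonzero:
  assumes "v \<in> gq_S2 l1 l2 l3"
  shows "v \<noteq> 0"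
  using assms by (auto simp: gq_S2_def gq_norm_def)

text \<open>The products of distinct imaginary units cancel by anticommutativity, and the remaining
  squares add up to minus the norm.\<close>

lemma gq_S2_square:
  assumes "v \<in> gq_S2 l1 l2 l3"
  shows "gq_mult l1 l2 l3 v v = - gq_one"
proof -
  have "gq_norm l1 l2 l3 v = 1"
    using assms by (simp add: gq_S2_def)
  then show ?thesis
    using gq_S2_nth_1[OF assms]
    by (simp add: gq_mult_def gq_norm_def gq_one_def vec_eq_iff forall_4
        power2_eq_square algebra_simps)
qed

lemma gq_polar_0: "gq_polar v 0 = gq_one"
  by (simp add: gq_polar_def)

lemma gq_polar_add:
  assumes "v \<in> gq_S2 l1 l2 l3"
  shows "gq_mult l1 l2 l3 (gq_polar v a) (gq_polar v b) = gq_polar v (a + b)"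
  using bilinear_gq_mult[of l1 l2 l3] gq_S2_square[OF assms]
  by (simp add: gq_polar_def bilinear_ladd bilinear_radd bilinear_lmul bilinear_rmul
      cos_add sin_add algebra_simps)

lemma gq_polar_eq_iff:
  assumes "v \<in> gq_S2 l1 l2 l3"
  shows "gq_polar v a = gq_polar v b \<longleftrightarrow> (\<exists>k::int. a = b + 2 * pi * k)"
proof -
  have "gq_polar v a = gq_polar v b \<longleftrightarrow> sin a = sin b \<and> cos a = cos b"
  proof
    assume eq: "gq_polar v a = gq_polar v b"
    \<comment> \<open>The first coordinate of the imaginary vector \<open>v\<close> vanishes, so it only sees the cosine.\<close>
    then have "gq_polar v a $ 1 = gq_polar v b $ 1"
      by simp
    then have "cos a = cos b"
      using gq_S2_nth_1[OF assms] by (simp add: gq_polar_def gq_one_def)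
    with eq have "sin a = sin b"
      using gq_S2_nonzero[OF assms] by (simp add: gq_polar_def)
    with \<open>cos a = cos b\<close> show "sin a = sin b \<and> cos a = cos b"
      by simp
  qed (simp add: gq_polar_def)
  then show ?thesis
    by (simp add: sin_cos_eq_iff)
qed

lemma gq_matrix_one: "gq_matrix l1 l2 l3 gq_one = mat 1"
  by (simp add: gq_matrix_def matrix_def mat_def vec_eq_iff forall_4 axis_def)

text \<open>The first column of the matrix of \<open>p\<close> is \<open>p\<close> itself, being the image of \<open>1\<close>.\<close>

lemma gq_matrix_eq_iff: "gq_matrix l1 l2 l3 p = gq_matrix l1 l2 l3 q \<longleftrightarrow> p = q"
proof -
  have "gq_matrix l1 l2 l3 r $ i $ 1 = r $ i" for r i
    using exhaust_4[of i] by (auto simp: gq_matrix_def matrix_def gq_mult_def axis_def)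
  then show ?thesis
    by (metis vec_eq_iff)
qed

lemma gq_matrix_polar_funpow:
  assumes "v \<in> gq_S2 l1 l2 l3"
  shows "(((**) (gq_matrix l1 l2 l3 (gq_polar v t))) ^^ k) (mat 1)
    = gq_matrix l1 l2 l3 (gq_polar v (real k * t))"
  by (induction k)
    (simp_all add: gq_polar_0 gq_matrix_one gq_matrix_mult gq_polar_add[OF assms] algebra_simps)

lemma matrix_inv_eqI:
  fixes A B :: "'a::semiring_1 ^ 'n ^ 'n"
  assumes "A ** B = mat 1" and "B ** A = mat 1"
  shows "matrix_inv A = B"
proof -
  have "A ** matrix_inv A = mat 1 \<and> matrix_inv A ** A = mat 1"
    unfolding matrix_inv_def by (rule someI[of _ B]) (use assms in simp)
  then show ?thesis
    using assms by (metis matrix_mul_assoc matrix_mul_lid matrix_mul_rid)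
qed

lemma matrix_inv_polar:
  assumes "v \<in> gq_S2 l1 l2 l3"
  shows "matrix_inv (gq_matrix l1 l2 l3 (gq_polar v t)) = gq_matrix l1 l2 l3 (gq_polar v (- t))"
  by (rule matrix_inv_eqI)
    (simp_all add: gq_matrix_mult gq_polar_add[OF assms] gq_polar_0 gq_matrix_one)

lemma matrix_powi_polar:
  assumes "v \<in> gq_S2 l1 l2 l3"
  shows "matrix_powi (gq_matrix l1 l2 l3 (gq_polar v t)) n
    = gq_matrix l1 l2 l3 (gq_polar v (real_of_int n * t))"
  by (simp add: matrix_powi_def matrix_inv_polar[OF assms] gq_matrix_polar_funpow[OF assms])

theorem theorem4p7:
  fixes l1 l2 l3 \<theta> :: real and p v :: gquat and A :: "real ^ 4 ^ 4" and m n s :: int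
  assumes "gq_norm l1 l2 l3 p = 1"
    and "v \<in> gq_S2 l1 l2 l3"
    and "p = cos \<theta> *\<^sub>R gq_one + sin \<theta> *\<^sub>R v"
    and "real_of_int m = 2 * pi / \<theta>"
    and "0 < m" and "m \<noteq> 1"
    and "A = gq_matrix l1 l2 l3 p"
  shows "[n = s] (mod m) \<longleftrightarrow> matrix_powi A n = matrix_powi A s"
proof -
  \<comment> \<open>Division by zero yields zero, so a positive \<open>m\<close> rules out \<open>\<theta> = 0\<close>.\<close>
  have "\<theta> \<noteq> 0"
    using assms(4,5) by auto
  then have full_turn: "2 * pi = real_of_int m * \<theta>"
    using assms(4) by simp
  have "A = gq_matrix l1 l2 l3 (gq_polar v \<theta>)"
    using assms(3,7) by (simp add: gq_polar_def)
  then have "matrix_powi A n = matrix_powi A s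
      \<longleftrightarrow> (\<exists>k::int. real_of_int n * \<theta> = real_of_int s * \<theta> + 2 * pi * k)"
    by (simp add: matrix_powi_polar[OF assms(2)] gq_matrix_eq_iff gq_polar_eq_iff[OF assms(2)])
  also have "\<dots> \<longleftrightarrow> (\<exists>k. n = s + m * k)"
  proof -
    have "real_of_int n * \<theta> = real_of_int s * \<theta> + 2 * pi * k \<longleftrightarrow> n = s + m * k" for k :: int
    proof -
      have "real_of_int s * \<theta> + 2 * pi * k = real_of_int (s + m * k) * \<theta>"
        unfolding full_turn by (simp add: algebra_simps)
      then show ?thesis
        using \<open>\<theta> \<noteq> 0\<close> by (simp del: of_int_add of_int_mult)
    qed
    then show ?thesis
      by simp
  qed
  also have "\<dots> \<longleftrightarrow> [n = s] (mod m)"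
    by (metis cong_iff_lin cong_sym_eq)
  finally show ?thesis
    by simp
qed

end
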